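(* Let $X$ be a quaternionic right vector space and let $F:X\to X$ be a right-linear operator of finite rank $n$, represented as $F=\sum_{m=1}^nx_m\otimes x_m'$ with $x_m\in X$, $x_m'\in X'$, where $\{x_1,\dots,x_n\}$ is a basis of $\mathrm{Im}\,F$. Then $$T_{\mathbb H,1}(F)=2\sum_{m=1}^n\mathrm{Re}(\langle x_m',x_m\rangle),$$ and for $k\ge2$, $$T_{\mathbb H,1}(F^k)=2\sum_{m_1=1}^n\cdots\sum_{m_k=1}^n\mathrm{Re}\big(\langle x_{m_1}',x_{m_2}\rangle\langle x_{m_2}',x_{m_3}\rangle\cdots\langle x_{m_{k-1}}',x_{m_k}\rangle\langle x_{m_k}',x_{m_1}\rangle\big).$$ Furthermore, for $k\ge1$, $T_{\mathbb H,1}(F^k)$ does not depend on the choice of the vectors $x_m$, $x_m'$.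
   Context: $\mathbb H$ denotes the quaternions. $X'$ is the dual of $X$ (a left $\mathbb H$-vector space of right-linear functionals), $\langle x',x\rangle=x'(x)$, and $x\otimes x'$ denotes the rank-one operator $v\mapsto x\langle x',v\rangle$. For $A=(a_{\ell m})\in M_n(\mathbb H)$, $T_{\mathbb H,1}(A)=2\,\mathrm{Re}(\sum_\ell a_{\ell\ell})$ (the complex trace of the companion matrix of $A$). For a finite-rank operator $S=\sum_{i=1}^ry_i\otimes y_i'$ with $\{y_1,\dots,y_r\}$ a basis of $\mathrm{Im}\,S$, the matrix of $S$ is $A_S=(\langle y_i',y_j\rangle)_{i,j=1}^r\in M_r(\mathbb H)$, and $T_{\mathbb H,1}(S):=T_{\mathbb H,1}(A_S)$. *)

theory Defs
  imports Complex_Main "HOL-Library.FuncSet" "Jordan_Normal_Form.Matrix"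
begin

subsection \<open>Quaternions\<close>

text \<open>\<open>Quat a b c d\<close> is $a + b\,i + c\,j + d\,k$.\<close>

datatype quat = Quat (qRe: real) (qI: real) (qJ: real) (qK: real)

lemma quat_eqI:
  "qRe p = qRe q \<Longrightarrow> qI p = qI q \<Longrightarrow> qJ p = qJ q \<Longrightarrow> qK p = qK q \<Longrightarrow> p = q"
  by (rule quat.expand) auto

instantiation quat :: division_ring
begin

definition "0 = Quat 0 0 0 0"
definition "1 = Quat 1 0 0 0"
definition "p + q = Quat (qRe p + qRe q) (qI p + qI q) (qJ p + qJ q) (qK p + qK q)"
definition "- p = Quat (- qRe p) (- qI p) (- qJ p) (- qK p)"
definition "p - q = Quat (qRe p - qRe q) (qI p - qI q) (qJ p - qJ q) (qK p - qK q)"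
definition "p * q = Quat
  (qRe p * qRe q - qI p * qI q - qJ p * qJ q - qK p * qK q)
  (qRe p * qI q + qI p * qRe q + qJ p * qK q - qK p * qJ q)
  (qRe p * qJ q - qI p * qK q + qJ p * qRe q + qK p * qI q)
  (qRe p * qK q + qI p * qJ q - qJ p * qI q + qK p * qRe q)"
definition "inverse p =
  (let N = (qRe p)\<^sup>2 + (qI p)\<^sup>2 + (qJ p)\<^sup>2 + (qK p)\<^sup>2
   in Quat (qRe p / N) (- qI p / N) (- qJ p / N) (- qK p / N))"
definition "p div q = p * inverse (q :: quat)"

lemmas quat_defs = zero_quat_def one_quat_def plus_quat_def uminus_quat_def minus_quat_def
  times_quat_def

instance
proof
  fix p :: quat
  assume "p \<noteq> 0"
  define N where "N = (qRe p)\<^sup>2 + (qI p)\<^sup>2 + (qJ p)\<^sup>2 + (qK p)\<^sup>2"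
  have "N \<noteq> 0"
  proof
    assume "N = 0"
    then have "qRe p = 0 \<and> qI p = 0 \<and> qJ p = 0 \<and> qK p = 0"
      unfolding N_def by (smt (verit) zero_le_power2 power2_less_eq_zero_iff)
    with \<open>p \<noteq> 0\<close> show False
      by (auto simp: zero_quat_def intro: quat_eqI)
  qed
  have inv: "inverse p = Quat (qRe p / N) (- qI p / N) (- qJ p / N) (- qK p / N)"
    by (simp add: inverse_quat_def N_def Let_def)
  have one: "qRe p * qRe p / N + qI p * qI p / N + qJ p * qJ p / N + qK p * qK p / N = 1"
    using \<open>N \<noteq> 0\<close> by (simp add: N_def power2_eq_square flip: add_divide_distrib)
  show "inverse p * p = 1" "p * inverse p = 1"
    using one unfolding inv times_quat_def one_quat_def by (simp_all add: mult.commute)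
qed (auto simp: quat_defs divide_quat_def inverse_quat_def Let_def algebra_simps)

end


subsection \<open>Right quaternionic vector spaces\<close>

class quat_right_vector = ab_group_add +
  fixes scaleQ :: "'a \<Rightarrow> quat \<Rightarrow> 'a"  (infixl \<open>\<cdot>\<^sub>Q\<close> 75)
  assumes scaleQ_add_left: "(x + y) \<cdot>\<^sub>Q q = x \<cdot>\<^sub>Q q + y \<cdot>\<^sub>Q q"
    and scaleQ_add_right: "x \<cdot>\<^sub>Q (p + q) = x \<cdot>\<^sub>Q p + x \<cdot>\<^sub>Q q"
    and scaleQ_scaleQ: "(x \<cdot>\<^sub>Q p) \<cdot>\<^sub>Q q = x \<cdot>\<^sub>Q (p * q)"
    and scaleQ_one: "x \<cdot>\<^sub>Q 1 = x"

definition right_linear :: "('a::quat_right_vector \<Rightarrow> 'a) \<Rightarrow> bool" where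
  "right_linear F \<longleftrightarrow> (\<forall>u v. F (u + v) = F u + F v) \<and> (\<forall>v q. F (v \<cdot>\<^sub>Q q) = F v \<cdot>\<^sub>Q q)"

text \<open>The underlying set of $X'$; the pairing $\langle x', x\rangle$ is the application \<open>x' x\<close>.\<close>

definition right_dual :: "('a::quat_right_vector \<Rightarrow> quat) set" where
  "right_dual = {f. (\<forall>u v. f (u + v) = f u + f v) \<and> (\<forall>v q. f (v \<cdot>\<^sub>Q q) = f v * q)}"

definition rank_one :: "'a::quat_right_vector \<Rightarrow> ('a \<Rightarrow> quat) \<Rightarrow> 'a \<Rightarrow> 'a"  (infix \<open>\<otimes>\<^sub>Q\<close> 76) where
  "x \<otimes>\<^sub>Q x' = (\<lambda>v. x \<cdot>\<^sub>Q x' v)"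

definition right_span :: "'a::quat_right_vector set \<Rightarrow> 'a set" where
  "right_span B = {\<Sum>b\<in>S. b \<cdot>\<^sub>Q c b | S c. finite S \<and> S \<subseteq> B}"

definition right_independent :: "'a::quat_right_vector set \<Rightarrow> bool" where
  "right_independent B \<longleftrightarrow>
    (\<forall>S c. finite S \<and> S \<subseteq> B \<and> (\<Sum>b\<in>S. b \<cdot>\<^sub>Q c b) = 0 \<longrightarrow> (\<forall>b\<in>S. c b = 0))"

definition is_right_basis :: "'a::quat_right_vector set \<Rightarrow> 'a set \<Rightarrow> bool" where
  "is_right_basis B V \<longleftrightarrow> right_independent B \<and> right_span B = V"

definition has_finite_rank :: "('a::quat_right_vector \<Rightarrow> 'a) \<Rightarrow> nat \<Rightarrow> bool" where
  "has_finite_rank F n \<longleftrightarrow> (\<exists>B. finite B \<and> card B = n \<and> is_right_basis B (range F))"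

text \<open>\<open>represents S r y y'\<close>: $S = \sum_i y_i \otimes y_i'$, where the $r$ vectors $y_i$ are pairwise
  distinct and form a basis of $\mathrm{Im}\,S$. Indices run over \<open>0, \<dots>, r - 1\<close>, and \<open>r = 0\<close> is
  the representation of the zero operator.\<close>

definition represents ::
  "('a::quat_right_vector \<Rightarrow> 'a) \<Rightarrow> nat \<Rightarrow> (nat \<Rightarrow> 'a) \<Rightarrow> (nat \<Rightarrow> 'a \<Rightarrow> quat) \<Rightarrow> bool" where
  "represents S r y y' \<longleftrightarrow>
     inj_on y {..<r} \<and> is_right_basis (y ` {..<r}) (range S) \<and>
     (\<forall>i<r. y' i \<in> right_dual) \<and> (\<forall>v. S v = (\<Sum>i<r. (y i \<otimes>\<^sub>Q y' i) v))"


subsection \<open>The trace\<close>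

text \<open>The complex trace of the companion matrix of \<open>A\<close>, in which each diagonal entry
  $\alpha + \beta j$ of \<open>A\<close> contributes $\alpha + \overline{\alpha}$.\<close>

definition T_mat :: "quat mat \<Rightarrow> real" where
  "T_mat A = 2 * qRe (\<Sum>l<dim_row A. A $$ (l, l))"

definition repr_mat :: "nat \<Rightarrow> (nat \<Rightarrow> 'a) \<Rightarrow> (nat \<Rightarrow> 'a \<Rightarrow> quat) \<Rightarrow> quat mat" where
  "repr_mat r y y' = mat r r (\<lambda>(i, j). y' i (y j))"

text \<open>The choice below picks one admissible representation of \<open>S\<close>. It is only meaningful for
  right-linear \<open>S\<close> of finite rank, and independence of the choice is not part of the definition.\<close>

definition T_op :: "('a::quat_right_vector \<Rightarrow> 'a) \<Rightarrow> real" where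
  "T_op S = (let (r, y, y') = (SOME (r, y, y'). represents S r y y') in T_mat (repr_mat r y y'))"

text \<open>$2\sum_{m_1}\cdots\sum_{m_k}\mathrm{Re}(\langle x_{m_1}',x_{m_2}\rangle\cdots
  \langle x_{m_{k-1}}',x_{m_k}\rangle\langle x_{m_k}',x_{m_1}\rangle)$ for $k \ge 1$, the $k$-fold
  sum being taken over all index tuples $(m_1,\ldots,m_k)$, encoded as functions on
  \<open>{1..k}\<close>. The product is not commutative; \<open>prod_list\<close> keeps the factors in order.\<close>

definition cyclic_sum :: "nat \<Rightarrow> nat \<Rightarrow> (nat \<Rightarrow> 'a) \<Rightarrow> (nat \<Rightarrow> 'a \<Rightarrow> quat) \<Rightarrow> real" where
  "cyclic_sum k n x x' =
     2 * (\<Sum>m \<in> {1..k} \<rightarrow>\<^sub>E {..<n}.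
            qRe (prod_list (map (\<lambda>l. x' (m l) (x (m (Suc l)))) [1..<k]) * x' (m k) (x (m 1))))"

end

theory Submission
  imports Defs
begin

text \<open>
  The real part satisfies \<open>Re (p q) = Re (q p)\<close>. Hence, although the quaternions do not commute,
  \<open>\<Sum>\<^sub>j Re \<langle>u\<^sub>j', u\<^sub>j\<rangle>\<close> behaves like a trace: it depends only on the operator
  \<open>\<Sum>\<^sub>j u\<^sub>j \<otimes> u\<^sub>j'\<close>. Lemma \<open>trace_rank_one_sums_eq\<close> proves this when one of the two sums has
  independent vectors whose span contains the vectors of the other sum: expand the \<open>u\<^sub>j\<close> in the
  independent vectors, compare coefficients, and move the coefficients around under \<open>Re\<close>.

  The point is that a basis of \<open>Im F\<close> need not be a basis of \<open>Im F\<^sup>k\<close>, so \<open>T_op (F ^^ k)\<close> is not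
  computed from the \<open>x\<^sub>m\<close> by definition. Yet \<open>F\<^sup>k = F F\<^sup>k\<^sup>-\<^sup>1 = \<Sum>\<^sub>m x\<^sub>m \<otimes> (x\<^sub>m' \<circ> F\<^sup>k\<^sup>-\<^sup>1)\<close>, and
  \<open>Im F\<^sup>k\<close> lies in \<open>Im F\<close>, the span of the independent \<open>x\<^sub>m\<close>. So every representation of \<open>F\<^sup>k\<close> has
  trace \<open>2 \<Sum>\<^sub>m Re \<langle>x\<^sub>m', F\<^sup>k\<^sup>-\<^sup>1 x\<^sub>m\<rangle>\<close> (\<open>T_mat_power_eq\<close>). Inserting \<open>F = \<Sum>\<^sub>m x\<^sub>m \<otimes> x\<^sub>m'\<close> for each of the
  \<open>k - 1\<close> remaining factors turns this into the cyclic sum (\<open>cyclic_sum_eq\<close>).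

  Since the trace is defined by choosing a representation, one has to exist: \<open>Im F\<^sup>k\<close> is
  spanned by the finitely many vectors \<open>F\<^sup>k\<^sup>-\<^sup>1 x\<^sub>m\<close>, a minimal spanning subset of these is a
  basis, and the coordinates of \<open>F\<^sup>k v\<close> in it are right-linear in \<open>v\<close> (\<open>ex_represents_power\<close>).
\<close>

section \<open>Sums of scaled vectors\<close>

lemma qRe_mult_commute: "qRe (p * q) = qRe (q * p)"
  by (simp add: times_quat_def)

lemma qRe_sum: "qRe (sum f A) = (\<Sum>a\<in>A. qRe (f a))"
  using sum_comp_morphism[of qRe f A] by (simp add: zero_quat_def plus_quat_def comp_def)

lemma scaleQ_zero_left: "0 \<cdot>\<^sub>Q q = 0"
  using scaleQ_add_left[of 0 0 q] by simp

lemma scaleQ_zero_right: "v \<cdot>\<^sub>Q 0 = 0"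
  using scaleQ_add_right[of v 0 0] by simp

lemma scaleQ_minus_right: "v \<cdot>\<^sub>Q (- q) = - (v \<cdot>\<^sub>Q q)"
  using scaleQ_add_right[of v q "- q"] by (simp add: scaleQ_zero_right eq_neg_iff_add_eq_0 add.commute)

lemma scaleQ_diff_right: "v \<cdot>\<^sub>Q (p - q) = v \<cdot>\<^sub>Q p - v \<cdot>\<^sub>Q q"
  using scaleQ_add_right[of v p "- q"] by (simp add: scaleQ_minus_right)

lemma scaleQ_sum_left: "sum f A \<cdot>\<^sub>Q q = (\<Sum>a\<in>A. f a \<cdot>\<^sub>Q q)"
  using sum_comp_morphism[of "\<lambda>v. v \<cdot>\<^sub>Q q" f A]
  by (simp add: scaleQ_zero_left scaleQ_add_left comp_def)

lemma scaleQ_sum_right: "v \<cdot>\<^sub>Q sum f A = (\<Sum>a\<in>A. v \<cdot>\<^sub>Q f a)"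
  using sum_comp_morphism[of "\<lambda>q. v \<cdot>\<^sub>Q q" f A]
  by (simp add: scaleQ_zero_right scaleQ_add_right comp_def)

lemma right_linear_combination:
  assumes "right_linear F"
  shows "F (\<Sum>a\<in>A. f a \<cdot>\<^sub>Q c a) = (\<Sum>a\<in>A. F (f a) \<cdot>\<^sub>Q c a)"
proof -
  have add: "F (u + v) = F u + F v" and scale: "F (v \<cdot>\<^sub>Q q) = F v \<cdot>\<^sub>Q q" for u v q
    using assms by (auto simp: right_linear_def)
  have "F 0 = 0"
    using add[of 0 0] by simp
  then show ?thesis
    using sum_comp_morphism[of F "\<lambda>a. f a \<cdot>\<^sub>Q c a" A] by (simp add: add scale comp_def)
qed

lemma right_dual_combination:
  assumes "f \<in> right_dual"
  shows "f (\<Sum>a\<in>A. g a \<cdot>\<^sub>Q c a) = (\<Sum>a\<in>A. f (g a) * c a)"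
proof -
  have add: "f (u + v) = f u + f v" and scale: "f (v \<cdot>\<^sub>Q q) = f v * q" for u v q
    using assms by (auto simp: right_dual_def)
  have "f 0 = 0"
    using add[of 0 0] by simp
  then show ?thesis
    using sum_comp_morphism[of f "\<lambda>a. g a \<cdot>\<^sub>Q c a" A] by (simp add: add scale comp_def)
qed

lemma right_linear_funpow:
  assumes "right_linear F"
  shows "right_linear (F ^^ k)"
  using assms by (induction k) (auto simp: right_linear_def)


section \<open>Spans and bases\<close>

lemma right_span_finite:
  assumes "finite B"
  shows "right_span B = {\<Sum>b\<in>B. b \<cdot>\<^sub>Q c b | c. True}"
proof -
  have "\<exists>d. (\<Sum>b\<in>S. b \<cdot>\<^sub>Q c b) = (\<Sum>b\<in>B. b \<cdot>\<^sub>Q d b)" if "S \<subseteq> B" for S c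
    by (rule exI[of _ "\<lambda>b. if b \<in> S then c b else 0"], rule sum.mono_neutral_cong_left)
      (use that assms in \<open>auto simp: scaleQ_zero_right\<close>)
  then show ?thesis
    using assms unfolding right_span_def by blast
qed

lemma right_span_family:
  assumes "inj_on y {..<r::nat}"
  shows "right_span (y ` {..<r}) = {\<Sum>i<r. y i \<cdot>\<^sub>Q c i | c. True}"
proof -
  have "\<exists>d. (\<Sum>i<r. y i \<cdot>\<^sub>Q c i) = (\<Sum>i<r. y i \<cdot>\<^sub>Q d (y i))" for c
    by (rule exI[of _ "\<lambda>b. c (the_inv_into {..<r} y b)"])
      (simp add: the_inv_into_f_f[OF assms])
  then show ?thesis
    unfolding right_span_finite[OF finite_imageI[OF finite_lessThan]] sum.reindex[OF assms] comp_def
    by (safe; metis)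
qed

lemma right_independent_family:
  assumes inj: "inj_on y {..<r::nat}" and indep: "right_independent (y ` {..<r})"
    and eq: "(\<Sum>i<r. y i \<cdot>\<^sub>Q c i) = (\<Sum>i<r. y i \<cdot>\<^sub>Q d i)" and "i < r"
  shows "c i = d i"
proof -
  define e where "e b = (let i = the_inv_into {..<r} y b in c i - d i)" for b
  have e: "e (y i) = c i - d i" if "i < r" for i
    using that by (simp add: e_def the_inv_into_f_f[OF inj])
  have "(\<Sum>b\<in>y ` {..<r}. b \<cdot>\<^sub>Q e b) = 0"
    using eq by (simp add: sum.reindex[OF inj] e scaleQ_diff_right sum_subtractf)
  then have "e (y i) = 0"
    using indep \<open>i < r\<close> unfolding right_independent_def by blast
  then show ?thesis
    using e[OF \<open>i < r\<close>] by simp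
qed

lemma right_span_image:
  assumes "right_linear T"
  shows "right_span (T ` B) = T ` right_span B"
proof (intro equalityI subsetI)
  fix v assume "v \<in> right_span (T ` B)"
  then obtain S c where S: "finite S" "S \<subseteq> T ` B" and v: "v = (\<Sum>g\<in>S. g \<cdot>\<^sub>Q c g)"
    unfolding right_span_def by blast
  from S(2) obtain U where U: "U \<subseteq> B" "inj_on T U" "S = T ` U"
    unfolding subset_image_inj by blast
  have "v = T (\<Sum>b\<in>U. b \<cdot>\<^sub>Q c (T b))"
    by (simp add: v U(3) sum.reindex[OF U(2)] right_linear_combination[OF assms])
  moreover have "finite U"
    using S(1) U finite_imageD by blast
  then have "(\<Sum>b\<in>U. b \<cdot>\<^sub>Q c (T b)) \<in> right_span B"
    using U(1) unfolding right_span_def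
    by (intro CollectI exI[of _ U] exI[of _ "\<lambda>b. c (T b)"]) auto
  ultimately show "v \<in> T ` right_span B"
    by blast
next
  fix v assume "v \<in> T ` right_span B"
  then obtain S c where S: "finite S" "S \<subseteq> B" and v: "v = T (\<Sum>b\<in>S. b \<cdot>\<^sub>Q c b)"
    unfolding right_span_def by blast
  \<comment> \<open>\<open>T\<close> may identify elements of \<open>S\<close>; their coefficients are added up.\<close>
  have "v = (\<Sum>g\<in>T ` S. \<Sum>b | b \<in> S \<and> T b = g. T b \<cdot>\<^sub>Q c b)"
    unfolding v right_linear_combination[OF assms] using S(1) by (rule sum.image_gen)
  also have "\<dots> = (\<Sum>g\<in>T ` S. g \<cdot>\<^sub>Q (\<Sum>b | b \<in> S \<and> T b = g. c b))"
    by (simp add: scaleQ_sum_right)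
  finally show "v \<in> right_span (T ` B)"
    using S unfolding right_span_def
    by (intro CollectI exI[of _ "T ` S"] exI[of _ "\<lambda>g. \<Sum>b | b \<in> S \<and> T b = g. c b"]) auto
qed

text \<open>A nontrivial relation can be divided by one of its nonzero coefficients, on the right and in
  spite of noncommutativity; it then expresses one generator through the others.\<close>

lemma right_span_remove_dependent:
  assumes fin: "finite B" and dep: "\<not> right_independent B"
  obtains b where "b \<in> B" "right_span (B - {b}) = right_span B"
proof -
  from dep obtain S c b where S: "finite S" "S \<subseteq> B" and rel: "(\<Sum>b\<in>S. b \<cdot>\<^sub>Q c b) = 0"
    and b: "b \<in> S" "c b \<noteq> 0"
    unfolding right_independent_def by blast
  define e where "e a = (if a \<in> S then - (c a * inverse (c b)) else 0)" for a
  have "(\<Sum>a\<in>S. a \<cdot>\<^sub>Q c a) \<cdot>\<^sub>Q inverse (c b) = 0"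
    using rel by (simp add: scaleQ_zero_left)
  then have "b + (\<Sum>a\<in>S - {b}. a \<cdot>\<^sub>Q (c a * inverse (c b))) = 0"
    using b by (simp add: scaleQ_add_left scaleQ_sum_left scaleQ_scaleQ sum.remove[OF S(1) b(1)] scaleQ_one)
  then have "b = (\<Sum>a\<in>S - {b}. a \<cdot>\<^sub>Q e a)"
    by (simp add: e_def scaleQ_minus_right sum_negf eq_neg_iff_add_eq_0)
  also have "\<dots> = (\<Sum>a\<in>B - {b}. a \<cdot>\<^sub>Q e a)"
    by (rule sum.mono_neutral_left) (use fin S in \<open>auto simp: e_def scaleQ_zero_right\<close>)
  finally have b_eq: "b = (\<Sum>a\<in>B - {b}. a \<cdot>\<^sub>Q e a)" .
  have bB: "b \<in> B"
    using b S by blast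
  have "(\<Sum>a\<in>B. a \<cdot>\<^sub>Q d a) = (\<Sum>a\<in>B - {b}. a \<cdot>\<^sub>Q (d a + e a * d b))" for d
  proof -
    have "(\<Sum>a\<in>B. a \<cdot>\<^sub>Q d a) = b \<cdot>\<^sub>Q d b + (\<Sum>a\<in>B - {b}. a \<cdot>\<^sub>Q d a)"
      by (rule sum.remove[OF fin bB])
    also have "b \<cdot>\<^sub>Q d b = (\<Sum>a\<in>B - {b}. a \<cdot>\<^sub>Q e a) \<cdot>\<^sub>Q d b"
      using b_eq by simp
    finally show ?thesis
      by (simp add: scaleQ_sum_left scaleQ_scaleQ scaleQ_add_right sum.distrib add.commute)
  qed
  then have "right_span B \<subseteq> right_span (B - {b})"
    unfolding right_span_finite[OF fin] right_span_finite[OF finite_Diff[OF fin]]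
    by (auto intro: exI[of _ "\<lambda>a. d a + e a * d b" for d])
  moreover have "right_span (B - {b}) \<subseteq> right_span B"
    unfolding right_span_def by blast
  ultimately show thesis
    using that bB by blast
qed

lemma ex_right_basis_subset:
  assumes "finite G"
  shows "\<exists>B\<subseteq>G. is_right_basis B (right_span G)"
  using assms
proof (induction G rule: finite_psubset_induct)
  case (psubset G)
  show ?case
  proof (cases "right_independent G")
    case True
    then show ?thesis
      by (auto simp: is_right_basis_def)
  next
    case False
    with psubset.hyps obtain b where b: "b \<in> G" "right_span (G - {b}) = right_span G"
      using right_span_remove_dependent by blast
    then obtain B where "B \<subseteq> G - {b}" "is_right_basis B (right_span G)"
      using psubset.IH[of "G - {b}"] by auto
    then show ?thesis
      by blast
  qed
qed


section \<open>Representations and their traces\<close>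

lemma T_mat_repr_mat: "T_mat (repr_mat r y y') = 2 * (\<Sum>i<r. qRe (y' i (y i)))"
  by (simp add: T_mat_def repr_mat_def qRe_sum)

text \<open>Write \<open>u\<^sub>j = \<Sum>\<^sub>i y\<^sub>i c\<^sub>j\<^sub>i\<close>. By independence of the \<open>y\<^sub>i\<close>, equality of the operators forces
  \<open>y\<^sub>i' = \<Sum>\<^sub>j c\<^sub>j\<^sub>i u\<^sub>j'\<close>, and then \<open>Re (c\<^sub>j\<^sub>i \<langle>u\<^sub>j', y\<^sub>i\<rangle>) = Re (\<langle>u\<^sub>j', y\<^sub>i\<rangle> c\<^sub>j\<^sub>i) = Re \<langle>u\<^sub>j', y\<^sub>i c\<^sub>j\<^sub>i\<rangle>\<close>.
  For powers of an operator, the \<open>y\<^sub>i\<close> are a basis of \<open>Im F\<close> and the \<open>u\<^sub>j\<close> one of the possibly smaller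
  space \<open>Im F\<^sup>k\<close>, which is why only an inclusion of spans is asked for.\<close>

lemma trace_rank_one_sums_eq:
  fixes y :: "nat \<Rightarrow> 'a::quat_right_vector" and u :: "nat \<Rightarrow> 'a"
  assumes inj: "inj_on y {..<r}" and indep: "right_independent (y ` {..<r})"
    and span: "\<And>j. j < s \<Longrightarrow> u j \<in> right_span (y ` {..<r})"
    and dual: "\<And>j. j < s \<Longrightarrow> u' j \<in> right_dual"
    and eq: "\<And>v. (\<Sum>i<r. y i \<cdot>\<^sub>Q y' i v) = (\<Sum>j<s. u j \<cdot>\<^sub>Q u' j v)"
  shows "(\<Sum>i<r. qRe (y' i (y i))) = (\<Sum>j<s. qRe (u' j (u j)))"
proof -
  have "\<forall>j. \<exists>c. j < s \<longrightarrow> u j = (\<Sum>i<r. y i \<cdot>\<^sub>Q c i)"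
    using span unfolding right_span_family[OF inj] by blast
  then obtain c where u: "\<And>j. j < s \<Longrightarrow> u j = (\<Sum>i<r. y i \<cdot>\<^sub>Q c j i)"
    by metis
  have y': "y' i v = (\<Sum>j<s. c j i * u' j v)" if "i < r" for i v
  proof (rule right_independent_family[OF inj indep _ that, of "\<lambda>i. y' i v"])
    have "(\<Sum>i<r. y i \<cdot>\<^sub>Q y' i v) = (\<Sum>j<s. \<Sum>i<r. y i \<cdot>\<^sub>Q (c j i * u' j v))"
      unfolding eq by (intro sum.cong refl) (simp add: u scaleQ_sum_left scaleQ_scaleQ)
    also have "\<dots> = (\<Sum>i<r. y i \<cdot>\<^sub>Q (\<Sum>j<s. c j i * u' j v))"
      unfolding scaleQ_sum_right by (rule sum.swap)
    finally show "(\<Sum>i<r. y i \<cdot>\<^sub>Q y' i v) = (\<Sum>i<r. y i \<cdot>\<^sub>Q (\<Sum>j<s. c j i * u' j v))" .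
  qed
  have "(\<Sum>i<r. qRe (y' i (y i))) = (\<Sum>i<r. \<Sum>j<s. qRe (u' j (y i) * c j i))"
    by (simp add: y' qRe_sum qRe_mult_commute)
  also have "\<dots> = (\<Sum>j<s. \<Sum>i<r. qRe (u' j (y i) * c j i))"
    by (rule sum.swap)
  also have "\<dots> = (\<Sum>j<s. qRe (u' j (u j)))"
    by (intro sum.cong refl) (simp add: u right_dual_combination[OF dual] qRe_sum)
  finally show ?thesis .
qed

lemma represents_apply: "represents S r y y' \<Longrightarrow> S v = (\<Sum>i<r. y i \<cdot>\<^sub>Q y' i v)"
  by (simp add: represents_def rank_one_def)

lemma represents_member_range:
  assumes "represents S r y y'" "i < r"
  shows "y i \<in> range S"
proof -
  have "y i = (\<Sum>j<r. y j \<cdot>\<^sub>Q (if j = i then 1 else 0))"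
    using \<open>i < r\<close> by (simp add: if_distrib[of "\<lambda>q. _ \<cdot>\<^sub>Q q"] scaleQ_zero_right scaleQ_one cong: if_cong)
  then have "y i \<in> right_span (y ` {..<r})"
    using assms by (auto simp: represents_def right_span_family)
  then show ?thesis
    using assms by (simp add: represents_def is_right_basis_def)
qed

text \<open>The coordinates of \<open>S v\<close> in a basis of the range are unique, hence right-linear in \<open>v\<close>.\<close>

lemma ex_represents_of_basis:
  assumes lin: "right_linear S" and fin: "finite B" and basis: "is_right_basis B (range S)"
  shows "\<exists>r y y'. represents S r y y'"
proof -
  obtain y and r :: nat where B: "B = y ` {..<r}" and inj: "inj_on y {..<r}"
    using finite_imp_nat_seg_image_inj_on[OF fin] by (auto simp: lessThan_def)
  have indep: "right_independent (y ` {..<r})"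
    using basis by (simp add: is_right_basis_def B)
  have "\<forall>v. \<exists>c. S v = (\<Sum>i<r. y i \<cdot>\<^sub>Q c i)"
    using basis unfolding is_right_basis_def B right_span_family[OF inj] by blast
  then obtain c where c: "\<And>v. S v = (\<Sum>i<r. y i \<cdot>\<^sub>Q c v i)"
    by metis
  have "(\<lambda>v. c v i) \<in> right_dual" if "i < r" for i
    unfolding right_dual_def
  proof (intro CollectI conjI allI)
    fix u v
    have "(\<Sum>i<r. y i \<cdot>\<^sub>Q c (u + v) i) = (\<Sum>i<r. y i \<cdot>\<^sub>Q (c u i + c v i))"
      using lin by (simp add: right_linear_def scaleQ_add_right sum.distrib flip: c)
    then show "c (u + v) i = c u i + c v i"
      by (rule right_independent_family[OF inj indep _ that])
  next
    fix v q
    have "(\<Sum>i<r. y i \<cdot>\<^sub>Q c (v \<cdot>\<^sub>Q q) i) = (\<Sum>i<r. y i \<cdot>\<^sub>Q c v i) \<cdot>\<^sub>Q q"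
      using lin by (simp add: right_linear_def flip: c)
    then have "(\<Sum>i<r. y i \<cdot>\<^sub>Q c (v \<cdot>\<^sub>Q q) i) = (\<Sum>i<r. y i \<cdot>\<^sub>Q (c v i * q))"
      by (simp add: scaleQ_sum_left scaleQ_scaleQ)
    then show "c (v \<cdot>\<^sub>Q q) i = c v i * q"
      by (rule right_independent_family[OF inj indep _ that])
  qed
  then have "represents S r y (\<lambda>i v. c v i)"
    using inj basis by (simp add: represents_def B rank_one_def c)
  then show ?thesis
    by blast
qed

lemma ex_represents_power:
  assumes lin: "right_linear F" and rep: "represents F n x x'" and "k \<ge> 1"
  shows "\<exists>r y y'. represents (F ^^ k) r y y'"
proof -
  let ?T = "F ^^ (k - 1)"
  have "F ^^ k = ?T \<circ> F"
    using \<open>k \<ge> 1\<close> funpow_Suc_right[of "k - 1" F] by simp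
  then have "range (F ^^ k) = ?T ` range F"
    by (simp add: image_comp)
  also have "\<dots> = right_span (?T ` x ` {..<n})"
    using rep by (simp add: right_span_image[OF right_linear_funpow[OF lin]] represents_def is_right_basis_def)
  finally have range: "range (F ^^ k) = right_span (?T ` x ` {..<n})" .
  obtain B where "B \<subseteq> ?T ` x ` {..<n}" "is_right_basis B (range (F ^^ k))"
    using ex_right_basis_subset[of "?T ` x ` {..<n}"] unfolding range by auto
  moreover from this have "finite B"
    using finite_subset by blast
  ultimately show ?thesis
    using ex_represents_of_basis[OF right_linear_funpow[OF lin]] by blast
qed


section \<open>The trace of a power\<close>

lemma T_mat_power_eq:
  assumes rep: "represents F n x x'" and "k \<ge> 1" and rep_k: "represents (F ^^ k) r y y'"
  shows "T_mat (repr_mat r y y') = 2 * (\<Sum>i<n. qRe (x' i ((F ^^ (k - 1)) (x i))))"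
proof -
  have power: "F ^^ k = F \<circ> F ^^ (k - 1)"
    using \<open>k \<ge> 1\<close> funpow.simps(2)[of "k - 1" F] by simp
  have "(\<Sum>i<n. qRe (x' i ((F ^^ (k - 1)) (x i)))) = (\<Sum>j<r. qRe (y' j (y j)))"
  proof (rule trace_rank_one_sums_eq[where y = x and y' = "\<lambda>i v. x' i ((F ^^ (k - 1)) v)"])
    show "inj_on x {..<n}" "right_independent (x ` {..<n})"
      using rep by (simp_all add: represents_def is_right_basis_def)
    show "y' j \<in> right_dual" if "j < r" for j
      using rep_k that by (simp add: represents_def)
    show "y j \<in> right_span (x ` {..<n})" if "j < r" for j
    proof -
      have "y j \<in> range F"
        using represents_member_range[OF rep_k that] unfolding power by auto
      then show ?thesis
        using rep by (simp add: represents_def is_right_basis_def)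
    qed
    show "(\<Sum>i<n. x i \<cdot>\<^sub>Q x' i ((F ^^ (k - 1)) v)) = (\<Sum>j<r. y j \<cdot>\<^sub>Q y' j v)" for v
      unfolding represents_apply[OF rep, symmetric] represents_apply[OF rep_k, symmetric] power
      by simp
  qed
  then show ?thesis
    by (simp add: T_mat_repr_mat)
qed

lemma T_op_power_eq:
  assumes "right_linear F" and rep: "represents F n x x'" and "k \<ge> 1"
  shows "T_op (F ^^ k) = 2 * (\<Sum>i<n. qRe (x' i ((F ^^ (k - 1)) (x i))))"
proof -
  obtain r y y' where "(SOME (r, y, y'). represents (F ^^ k) r y y') = (r, y, y')"
    using prod_cases3 by blast
  moreover from this have "represents (F ^^ k) r y y'"
    using someI_ex[of "\<lambda>(r, y, y'). represents (F ^^ k) r y y'"] ex_represents_power[OF assms]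
    by auto
  ultimately show ?thesis
    using T_mat_power_eq[OF rep \<open>k \<ge> 1\<close>, of r y y'] by (simp add: T_op_def)
qed

text \<open>Summing over the last index replaces \<open>\<langle>x\<^sub>i', x\<^sub>j\<rangle> \<langle>x\<^sub>j', v\<rangle>\<close> by \<open>\<langle>x\<^sub>i', F v\<rangle>\<close>. For an induction on
  the number of factors, the closing vector is therefore an arbitrary \<open>w m\<^sub>1\<close> depending on the
  first index, which becomes \<open>F (w m\<^sub>1)\<close> at each step.\<close>

lemma sum_tuples_eq:
  assumes rep: "represents F n x x'"
  shows "(\<Sum>m \<in> {1..Suc k} \<rightarrow>\<^sub>E {..<n}.
      qRe (prod_list (map (\<lambda>l. x' (m l) (x (m (Suc l)))) [1..<Suc k]) * x' (m (Suc k)) (w (m 1))))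
    = (\<Sum>i<n. qRe (x' i ((F ^^ k) (w i))))"
proof (induction k arbitrary: w)
  case 0
  have "(\<Sum>m \<in> {1::nat} \<rightarrow>\<^sub>E {..<n}. qRe (x' (m 1) (w (m 1)))) = (\<Sum>i<n. qRe (x' i (w i)))"
  proof (rule sum.reindex_bij_witness[of _ "\<lambda>i. \<lambda>l\<in>{1}. i" "\<lambda>m. m 1"])
    show "(\<lambda>l\<in>{1}. m 1) = m" if "m \<in> {1} \<rightarrow>\<^sub>E {..<n}" for m :: "nat \<Rightarrow> nat"
      by (rule PiE_ext[OF _ that]) (use PiE_mem[OF that] in \<open>simp_all add: restrict_PiE_iff\<close>)
    show "m 1 \<in> {..<n}" if "m \<in> {1} \<rightarrow>\<^sub>E {..<n}" for m :: "nat \<Rightarrow> nat"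
      using PiE_mem[OF that] by simp
    show "(\<lambda>l\<in>{1}. i) \<in> {1} \<rightarrow>\<^sub>E {..<n}" if "i \<in> {..<n}" for i
      using that by (simp add: restrict_PiE_iff)
  qed simp_all
  then show ?case
    by simp
next
  case (Suc k)
  define P where "P k m = prod_list (map (\<lambda>l. x' (m l) (x (m (Suc l)))) [1..<k])" for k m
  let ?I = "{1..Suc k} \<rightarrow>\<^sub>E {..<n}"
  have dual: "x' i \<in> right_dual" if "i < n" for i
    using rep that by (simp add: represents_def)
  have prefix: "P (Suc k) (m(Suc (Suc k) := j)) = P (Suc k) m" for m j
    unfolding P_def by (intro arg_cong[where f = prod_list] map_cong) auto
  have step: "P (Suc (Suc k)) (m(Suc (Suc k) := j)) = P (Suc k) m * x' (m (Suc k)) (x j)" for m j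
  proof -
    have "[1..<Suc (Suc k)] = [1..<Suc k] @ [Suc k]"
      by simp
    then show ?thesis
      using prefix[of m j] by (simp add: P_def del: upt_Suc)
  qed
  have set: "{1..Suc (Suc k)} = insert (Suc (Suc k)) {1..Suc k}"
    by auto
  have "(\<Sum>m \<in> {1..Suc (Suc k)} \<rightarrow>\<^sub>E {..<n}.
        qRe (P (Suc (Suc k)) m * x' (m (Suc (Suc k))) (w (m 1))))
      = (\<Sum>(j, m) \<in> {..<n} \<times> ?I.
        qRe (P (Suc k) m * x' (m (Suc k)) (x j) * x' j (w (m 1))))"
    unfolding set PiE_insert_eq
    by (subst sum.reindex[OF inj_combinator])
      (auto simp: case_prod_unfold step intro!: sum.cong)
  also have "\<dots> = (\<Sum>m\<in>?I. \<Sum>j<n. qRe (P (Suc k) m * x' (m (Suc k)) (x j) * x' j (w (m 1))))"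
    unfolding sum.cartesian_product[symmetric] by (rule sum.swap)
  also have "\<dots> = (\<Sum>m\<in>?I. qRe (P (Suc k) m * x' (m (Suc k)) (F (w (m 1)))))"
  proof (rule sum.cong[OF refl])
    fix m assume "m \<in> ?I"
    then have "m (Suc k) < n"
      using PiE_mem[of m "{1..Suc k}" "\<lambda>_. {..<n}" "Suc k"] by simp
    then show "(\<Sum>j<n. qRe (P (Suc k) m * x' (m (Suc k)) (x j) * x' j (w (m 1))))
        = qRe (P (Suc k) m * x' (m (Suc k)) (F (w (m 1))))"
      by (simp add: represents_apply[OF rep] right_dual_combination[OF dual] sum_distrib_left
          qRe_sum mult.assoc)
  qed
  also have "\<dots> = (\<Sum>i<n. qRe (x' i ((F ^^ k) (F (w i)))))"
    unfolding P_def by (rule Suc.IH)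
  finally show ?case
    by (simp only: P_def funpow_Suc_right comp_def)
qed

lemma cyclic_sum_eq:
  assumes "represents F n x x'" and "k \<ge> 1"
  shows "cyclic_sum k n x x' = 2 * (\<Sum>i<n. qRe (x' i ((F ^^ (k - 1)) (x i))))"
  using sum_tuples_eq[OF assms(1), of "k - 1" x] \<open>k \<ge> 1\<close> by (simp add: cyclic_sum_def)

theorem corollary3p10:
  fixes F :: "'x::quat_right_vector \<Rightarrow> 'x"
    and n :: nat
    and x :: "nat \<Rightarrow> 'x"
    and x' :: "nat \<Rightarrow> 'x \<Rightarrow> quat"
  assumes "right_linear F"
    and "has_finite_rank F n"
    and "represents F n x x'"
  shows "T_op F = 2 * (\<Sum>m<n. qRe (x' m (x m))) \<and>
    (\<forall>k\<ge>2. T_op (F ^^ k) = cyclic_sum k n x x') \<and>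
    (\<forall>k\<ge>1. \<forall>p z z'. represents F p z z' \<longrightarrow> cyclic_sum k p z z' = cyclic_sum k n x x') \<and>
    (\<forall>k\<ge>1. (\<exists>r y y'. represents (F ^^ k) r y y') \<and>
      (\<forall>r y y'. represents (F ^^ k) r y y' \<longrightarrow> T_mat (repr_mat r y y') = T_op (F ^^ k)))"
proof (intro conjI allI impI)
  note lin = assms(1) and rep = assms(3)
  have power: "T_op (F ^^ k) = cyclic_sum k p z z'" if "k \<ge> 1" "represents F p z z'" for k p z z'
    using T_op_power_eq[OF lin that(2,1)] cyclic_sum_eq[OF that(2,1)] by simp
  show "T_op F = 2 * (\<Sum>m<n. qRe (x' m (x m)))"
    using T_op_power_eq[OF lin rep, of 1] by simp
  show "T_op (F ^^ k) = cyclic_sum k n x x'" if "k \<ge> 2" for k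
    using power[OF _ rep] that by simp
  show "cyclic_sum k p z z' = cyclic_sum k n x x'" if "k \<ge> 1" "represents F p z z'" for k p z z'
    using power[OF that] power[OF that(1) rep] by simp
  show "\<exists>r y y'. represents (F ^^ k) r y y'" if "k \<ge> 1" for k
    using ex_represents_power[OF lin rep that] .
  show "T_mat (repr_mat r y y') = T_op (F ^^ k)"
    if "k \<ge> 1" "represents (F ^^ k) r y y'" for k r y y'
    using T_mat_power_eq[OF rep that] T_op_power_eq[OF lin rep that(1)] by simp
qed

end
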